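(* Let $\mathcal{H}\subseteq L^2(\mathcal{T})$ be a Hilbert space with inner product $\langle\cdot,\cdot\rangle_{\mathcal{H}}$ and norm $\|\cdot\|_{\mathcal{H}}$, and let $\{b_m\}_{m=1}^\infty$ be an orthonormal basis that is complete in $\mathcal{H}$. Let $c\in\mathcal{H}$ be a coefficient function and $z$ a functional random variable with values in $\mathcal{H}$. Put $\phi_m=\langle c,b_m\rangle_{\mathcal{H}}$ and $x_m=\langle z,b_m\rangle_{\mathcal{H}}$, and assume there are constants $s_c,C_c,s_z,C_z>0$ such that for every $K_n\in\mathbb{N}$ $$\Big\|c-\sum_{m=1}^{K_n}\phi_m b_m\Big\|_{\mathcal{H}}\le C_cK_n^{-s_c},\qquad \mathbb{E}\Big[\Big\|z-\sum_{m=1}^{K_n}x_m b_m\Big\|_{\mathcal{H}}^2\Big]\le C_zK_n^{-2s_z}.$$ Let $z_0\in\mathcal{H}$, $x_{0,m}=\langle z_0,b_m\rangle_{\mathcal{H}}$, and assume there are constants $C_{z_0},s_{z_0}>0$ such that for every $K_n\in\mathbb{N}$ $$\Big\|z_0-\sum_{m=1}^{K_n}x_{0,m}b_m\Big\|_{\mathcal{H}}\le C_{z_0}K_n^{-s_{z_0}}.$$ Let $B_c=\|c\|_{\mathcal{H}}$ and $B_{z_0}=\|z_0\|_{\mathcal{H}}$ be finite, and write $\boldsymbol{\phi}=(\phi_1,\dots,\phi_{K_n})^\top$, $\boldsymbol{x}_0^{(z)}=(x_{0,1},\dots,x_{0,K_n})^\top$. Then for any structural function $f$ that is Lipschitz continuous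 in its functional-term argument with Lipschitz constant $L_f$, under the intervention $\mathrm{do}(z=z_0)$ the pointwise error satisfies, for every $K_n\in\mathbb{N}$, $$\big\|f(\dots,\langle c,z_0\rangle_{\mathcal{H}},\dots,u)-f(\dots,\boldsymbol{\phi}^\top\boldsymbol{x}_0^{(z)},\dots,u)\big\|\le L_f\big(B_{z_0}C_cK_n^{-s_c}+(B_c+C_c)C_{z_0}K_n^{-s_{z_0}}\big).$$ Consequently the error is of order $O(K_n^{-\min(s_c,s_{z_0})})$ as $K_n\to\infty$; in particular, the error in the interventional mean of $x$ (the difference between the means of $x$ under the exact and the truncated structural equation) decays at the same polynomial rate.
   Context: The endogenous variable $x$ is generated by a structural equation $x=f(\dots,\langle c,z\rangle_{\mathcal{H}},\dots,u)$, where the dots stand for the remaining (parent/adjustment) arguments, $u$ is exogenous noise, and the functional variable $z$ enters only through the scalar "functional term" $\langle c,z\rangle_{\mathcal{H}}$. Lipschitz continuity in the functional term with constant $L_f$ means $\|f(\dots,s,\dots,u)-f(\dots,s',\dots,u)\|\le L_f|s-s'|$ for all $s,s'\in\mathbb{R}$ and all values of the remaining arguments and $u$. In the finite-dimensional approximation the functional term is replaced by $\boldsymbol{\phi}^\top\boldsymbol{x}^{(z)}=\sum_{m=1}^{K_n}\phi_mx_m$. The intervention $\mathrm{do}(z=z_0)$ fixes $z$ at $z_0$ (correspondingly, $\boldsymbol{x}^{(z)}$ at $\boldsymbol{x}_0^{(z)}$); in both expressions compared, the remaining arguments and the noise $u$ take the same values. *)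

theory Defs
  imports "HOL-Probability.Probability" "HOL-Library.Landau_Symbols"
begin

text \<open>
  The Hilbert space \<open>H \<subseteq> L\<^sup>2(T)\<close>, which carries its own inner product (not necessarily that of
  \<open>L\<^sup>2(T)\<close>), is a type \<open>'h\<close> of class \<open>{real_inner, complete_space}\<close> together with a map \<open>\<iota>\<close>
  sending each element to a representative of its class in \<open>L\<^sup>2(T)\<close>. Since \<open>\<iota>\<close> picks
  representatives, it is linear and injective only up to null sets.
\<close>

definition L2_embedding :: "'t measure \<Rightarrow> ('h::real_vector \<Rightarrow> 't \<Rightarrow> real) \<Rightarrow> bool" where
  "L2_embedding T \<iota> \<longleftrightarrow>
     (\<forall>h. \<iota> h \<in> borel_measurable T \<and> integrable T (\<lambda>t. (\<iota> h t)\<^sup>2)) \<and>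
     (\<forall>g h. AE t in T. \<iota> (g + h) t = \<iota> g t + \<iota> h t) \<and>
     (\<forall>a h. AE t in T. \<iota> (a *\<^sub>R h) t = a * \<iota> h t) \<and>
     (\<forall>h. (AE t in T. \<iota> h t = 0) \<longrightarrow> h = 0)"

text \<open>Basis sequences are indexed from 1; the value at index 0 is irrelevant.\<close>

definition complete_orthonormal_basis :: "(nat \<Rightarrow> 'h::real_inner) \<Rightarrow> bool" where
  "complete_orthonormal_basis b \<longleftrightarrow>
     (\<forall>i\<ge>1. \<forall>j\<ge>1. b i \<bullet> b j = (if i = j then 1 else 0)) \<and>
     closure (span (b ` {1..})) = UNIV"

text \<open>
  The endogenous variable as a random variable on the sample space \<open>'w\<close>, under the exact and the
  truncated structural equation. The arguments \<open>P\<close>, \<open>Q\<close> are the random arguments before and after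
  the functional term, and \<open>U\<close> is the noise. The functional variable enters through the random
  element \<open>Z\<close>, resp. the random scores \<open>X 1, X 2, \<dots>\<close>; an intervention replaces these by constant
  functions on the sample space (and \<open>P\<close>, \<open>Q\<close> by the values they take under the intervention).
\<close>

definition exact_outcome ::
  "('p \<Rightarrow> real \<Rightarrow> 'q \<Rightarrow> 'u \<Rightarrow> 'x) \<Rightarrow> 'h::real_inner \<Rightarrow>
   ('w \<Rightarrow> 'p) \<Rightarrow> ('w \<Rightarrow> 'h) \<Rightarrow> ('w \<Rightarrow> 'q) \<Rightarrow> ('w \<Rightarrow> 'u) \<Rightarrow> 'w \<Rightarrow> 'x" where
  "exact_outcome f c P Z Q U = (\<lambda>\<omega>. f (P \<omega>) (c \<bullet> Z \<omega>) (Q \<omega>) (U \<omega>))"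

definition truncated_outcome ::
  "('p \<Rightarrow> real \<Rightarrow> 'q \<Rightarrow> 'u \<Rightarrow> 'x) \<Rightarrow> (nat \<Rightarrow> real) \<Rightarrow> nat \<Rightarrow>
   ('w \<Rightarrow> 'p) \<Rightarrow> (nat \<Rightarrow> 'w \<Rightarrow> real) \<Rightarrow> ('w \<Rightarrow> 'q) \<Rightarrow> ('w \<Rightarrow> 'u) \<Rightarrow> 'w \<Rightarrow> 'x" where
  "truncated_outcome f \<phi> K P X Q U =
     (\<lambda>\<omega>. f (P \<omega>) (\<Sum>m=1..K. \<phi> m * X m \<omega>) (Q \<omega>) (U \<omega>))"

end

(* Since phi^T x_0 is the inner product of the truncated c with z_0, the error in the functional
   term is the inner product of the tail of c with z_0. By Cauchy-Schwarz the B_z0 C_c K^(-s_c)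
   term alone therefore bounds it, and the second term of the stated bound is slack. *)

theory Submission
  imports Defs
begin

text \<open>By bilinearity and symmetry of the inner product: the m-th product of coefficients is
  the inner product of the m-th term of the expansion of \<open>c\<close> with \<open>z\<close>.
  Only \<open>c\<close> is thus truncated, and \<open>z\<close> stays whole.\<close>

lemma inner_diff_sum_eq_inner_remainder:
  fixes c z :: "'h::real_inner"
  shows "c \<bullet> z - (\<Sum>m\<in>I. (c \<bullet> b m) * (z \<bullet> b m)) = (c - (\<Sum>m\<in>I. (c \<bullet> b m) *\<^sub>R b m)) \<bullet> z"
  by (simp add: inner_diff_left inner_sum_left inner_commute[of z])

text \<open>A bounded measurable function is integrable on a probability space, so \<open>Y\<close>
  differs from the integrable \<open>X\<close> by an integrable function. As the total mass is 1,
  the uniform bound passes to the means with the same constant.\<close>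

lemma (in prob_space) expectation_dist_le:
  fixes X Y :: "'a \<Rightarrow> 'x::{banach, second_countable_topology}"
  assumes X: "integrable M X" and Y: "Y \<in> borel_measurable M"
    and le: "\<And>\<omega>. norm (X \<omega> - Y \<omega>) \<le> B"
  shows "integrable M Y" and "norm ((\<integral>\<omega>. X \<omega> \<partial>M) - (\<integral>\<omega>. Y \<omega> \<partial>M)) \<le> B"
proof -
  have D: "integrable M (\<lambda>\<omega>. X \<omega> - Y \<omega>)"
    using X Y le by (intro integrable_const_bound[where B = B]) auto
  have "integrable M (\<lambda>\<omega>. X \<omega> - (X \<omega> - Y \<omega>))"
    using X D by (rule Bochner_Integration.integrable_diff)
  then show IY: "integrable M Y"
    by simp
  have "norm ((\<integral>\<omega>. X \<omega> \<partial>M) - (\<integral>\<omega>. Y \<omega> \<partial>M)) = norm (\<integral>\<omega>. X \<omega> - Y \<omega> \<partial>M)"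
    using X IY by simp
  also have "\<dots> \<le> (\<integral>\<omega>. norm (X \<omega> - Y \<omega>) \<partial>M)"
    by (rule integral_norm_bound)
  also have "\<dots> \<le> B"
    using D le by (intro integral_le_const) auto
  finally show "norm ((\<integral>\<omega>. X \<omega> \<partial>M) - (\<integral>\<omega>. Y \<omega> \<partial>M)) \<le> B" .
qed

text \<open>For a base of at least 1, raising the exponent only weakens a power bound. This turns
  explicit error bounds into the claimed rate.\<close>

lemma norm_bigo_powrI:
  fixes g :: "nat \<Rightarrow> 'x::real_normed_vector"
  assumes "\<And>K. K \<ge> 1 \<Longrightarrow> norm (g K) \<le> A * real K powr a" and "a \<le> a'"
  shows "(\<lambda>K. norm (g K)) \<in> O(\<lambda>K. real K powr a')"
\<comment> \<open>The absolute value replaces \<open>A\<close>, whose sign is not known. Index 0 is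
  skipped because \<open>0 powr a = 0\<close>, where the bound may fail.\<close>
proof (rule bigoI[where c = "\<bar>A\<bar>"], rule eventually_sequentiallyI[where c = 1])
  fix K :: nat assume K: "K \<ge> 1"
  have "norm (g K) \<le> A * real K powr a"
    using assms(1) K by blast
  also have "\<dots> \<le> \<bar>A\<bar> * real K powr a"
    by (intro mult_right_mono) auto
  also have "\<dots> \<le> \<bar>A\<bar> * real K powr a'"
    using K assms(2) by (intro mult_left_mono powr_mono) auto
  finally show "norm (norm (g K)) \<le> \<bar>A\<bar> * norm (real K powr a')"
    by simp
qed

theorem theorem2:
  fixes T :: "'t measure"
    and \<iota> :: "'h::{real_inner, complete_space} \<Rightarrow> 't \<Rightarrow> real"
    and b :: "nat \<Rightarrow> 'h"
    and c z\<^sub>0 :: 'h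
    and M :: "'w measure"
    and z :: "'w \<Rightarrow> 'h"
    and \<phi> x\<^sub>0 :: "nat \<Rightarrow> real"
    and x :: "nat \<Rightarrow> 'w \<Rightarrow> real"
    and s\<^sub>c C\<^sub>c s\<^sub>z C\<^sub>z s\<^sub>z\<^sub>0 C\<^sub>z\<^sub>0 B\<^sub>c B\<^sub>z\<^sub>0 L\<^sub>f :: real
    and f :: "'p \<Rightarrow> real \<Rightarrow> 'q \<Rightarrow> 'u \<Rightarrow> 'x::{banach, second_countable_topology}"
  assumes "L2_embedding T \<iota>"
    and "complete_orthonormal_basis b"
    and "prob_space M"
    and "z \<in> borel_measurable M"
    and "\<And>m. \<phi> m = c \<bullet> b m"
    and "\<And>m \<omega>. x m \<omega> = z \<omega> \<bullet> b m"
    and "s\<^sub>c > 0" "C\<^sub>c > 0" "s\<^sub>z > 0" "C\<^sub>z > 0"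
    and "\<And>K. K \<ge> 1 \<Longrightarrow> norm (c - (\<Sum>m=1..K. \<phi> m *\<^sub>R b m)) \<le> C\<^sub>c * real K powr (- s\<^sub>c)"
    and "\<And>K. K \<ge> 1 \<Longrightarrow> integrable M (\<lambda>\<omega>. (norm (z \<omega> - (\<Sum>m=1..K. x m \<omega> *\<^sub>R b m)))\<^sup>2)"
    and "\<And>K. K \<ge> 1 \<Longrightarrow> (\<integral>\<omega>. (norm (z \<omega> - (\<Sum>m=1..K. x m \<omega> *\<^sub>R b m)))\<^sup>2 \<partial>M)
                        \<le> C\<^sub>z * real K powr (- 2 * s\<^sub>z)"
    and "\<And>m. x\<^sub>0 m = z\<^sub>0 \<bullet> b m"
    and "C\<^sub>z\<^sub>0 > 0" "s\<^sub>z\<^sub>0 > 0"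
    and "\<And>K. K \<ge> 1 \<Longrightarrow> norm (z\<^sub>0 - (\<Sum>m=1..K. x\<^sub>0 m *\<^sub>R b m)) \<le> C\<^sub>z\<^sub>0 * real K powr (- s\<^sub>z\<^sub>0)"
    and "B\<^sub>c = norm c" "B\<^sub>z\<^sub>0 = norm z\<^sub>0"
    and "\<And>p q u. L\<^sub>f-lipschitz_on UNIV (\<lambda>s. f p s q u)"
  shows "(\<forall>K\<ge>1. \<forall>p q u.
            norm (f p (c \<bullet> z\<^sub>0) q u - f p (\<Sum>m=1..K. \<phi> m * x\<^sub>0 m) q u)
              \<le> L\<^sub>f * (B\<^sub>z\<^sub>0 * C\<^sub>c * real K powr (- s\<^sub>c) + (B\<^sub>c + C\<^sub>c) * C\<^sub>z\<^sub>0 * real K powr (- s\<^sub>z\<^sub>0)))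
       \<and> (\<forall>p q u.
            (\<lambda>K. norm (f p (c \<bullet> z\<^sub>0) q u - f p (\<Sum>m=1..K. \<phi> m * x\<^sub>0 m) q u))
              \<in> O(\<lambda>K. real K powr (- min s\<^sub>c s\<^sub>z\<^sub>0)))
       \<and> (\<forall>P Q U.
            (\<forall>s. (\<lambda>\<omega>. f (P \<omega>) s (Q \<omega>) (U \<omega>)) \<in> borel_measurable M) \<longrightarrow>
            integrable M (exact_outcome f c P (\<lambda>_. z\<^sub>0) Q U) \<longrightarrow>
            (\<forall>K\<ge>1. integrable M (truncated_outcome f \<phi> K P (\<lambda>m _. x\<^sub>0 m) Q U)) \<and>
            (\<lambda>K. norm ((\<integral>\<omega>. exact_outcome f c P (\<lambda>_. z\<^sub>0) Q U \<omega> \<partial>M)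
                       - (\<integral>\<omega>. truncated_outcome f \<phi> K P (\<lambda>m _. x\<^sub>0 m) Q U \<omega> \<partial>M)))
              \<in> O(\<lambda>K. real K powr (- min s\<^sub>c s\<^sub>z\<^sub>0)))"
proof -
  interpret prob_space M by fact
  \<comment> \<open>Nonnegativity of the constant is built into \<open>lipschitz_on\<close>.\<close>
  have L: "L\<^sub>f \<ge> 0"
    using assms(20) by (rule lipschitz_on_nonneg)
  define S where "S K = (\<Sum>m=1..K. \<phi> m * x\<^sub>0 m)" for K
  \<comment> \<open>The sharper bound, without the slack term, in the shape constant times power
    that \<open>norm_bigo_powrI\<close> expects. It is free of \<open>p\<close>, \<open>q\<close>,
    \<open>u\<close>, which the passage to the mean relies on.\<close>
  define \<epsilon> where "\<epsilon> K = L\<^sub>f * B\<^sub>z\<^sub>0 * C\<^sub>c * real K powr (- s\<^sub>c)" for K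
  have err: "norm (f p (c \<bullet> z\<^sub>0) q u - f p (S K) q u) \<le> \<epsilon> K" if K: "K \<ge> 1" for K p q u
  proof -
    have "\<bar>c \<bullet> z\<^sub>0 - S K\<bar> = \<bar>(c - (\<Sum>m=1..K. \<phi> m *\<^sub>R b m)) \<bullet> z\<^sub>0\<bar>"
      unfolding S_def assms(5,14) by (simp only: inner_diff_sum_eq_inner_remainder)
    also have "\<dots> \<le> norm (c - (\<Sum>m=1..K. \<phi> m *\<^sub>R b m)) * norm z\<^sub>0"
      by (rule Cauchy_Schwarz_ineq2)
    also have "\<dots> \<le> C\<^sub>c * real K powr (- s\<^sub>c) * norm z\<^sub>0"
      using assms(11)[OF K] by (intro mult_right_mono) auto
    finally have "L\<^sub>f * \<bar>c \<bullet> z\<^sub>0 - S K\<bar> \<le> L\<^sub>f * (C\<^sub>c * real K powr (- s\<^sub>c) * norm z\<^sub>0)"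
      using L by (rule mult_left_mono)
    then have "L\<^sub>f * \<bar>c \<bullet> z\<^sub>0 - S K\<bar> \<le> \<epsilon> K"
      unfolding \<epsilon>_def assms(19) by (simp only: mult_ac)
    moreover have "norm (f p (c \<bullet> z\<^sub>0) q u - f p (S K) q u) \<le> L\<^sub>f * \<bar>c \<bullet> z\<^sub>0 - S K\<bar>"
      using lipschitz_onD[OF assms(20), of "c \<bullet> z\<^sub>0" "S K" p q u]
      by (simp add: dist_norm)
    ultimately show ?thesis
      by linarith
  qed
  have pointwise: "norm (f p (c \<bullet> z\<^sub>0) q u - f p (S K) q u)
      \<le> L\<^sub>f * (B\<^sub>z\<^sub>0 * C\<^sub>c * real K powr (- s\<^sub>c) + (B\<^sub>c + C\<^sub>c) * C\<^sub>z\<^sub>0 * real K powr (- s\<^sub>z\<^sub>0))"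
    if K: "K \<ge> 1" for K p q u
  proof -
    \<comment> \<open>The slack term may be added to the sharper bound since all its factors are
      nonnegative, \<open>B\<^sub>c\<close> being a norm.\<close>
    have "0 \<le> L\<^sub>f * ((B\<^sub>c + C\<^sub>c) * C\<^sub>z\<^sub>0 * real K powr (- s\<^sub>z\<^sub>0))"
      using L assms(8,15,18) by simp
    with err[OF K, of p q u] show ?thesis
      unfolding \<epsilon>_def by (simp add: algebra_simps)
  qed
  have rate: "- s\<^sub>c \<le> - min s\<^sub>c s\<^sub>z\<^sub>0"
    by simp
  have bigo: "(\<lambda>K. norm (f p (c \<bullet> z\<^sub>0) q u - f p (S K) q u)) \<in> O(\<lambda>K. real K powr (- min s\<^sub>c s\<^sub>z\<^sub>0))"
    for p q u
    using err rate unfolding \<epsilon>_def by (rule norm_bigo_powrI)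
  \<comment> \<open>Integrability is claimed along with the rate because the integral of a
    nonintegrable function is 0 by convention; this way the rate compares genuine means.\<close>
  have mean: "(\<forall>K\<ge>1. integrable M (truncated_outcome f \<phi> K P (\<lambda>m _. x\<^sub>0 m) Q U)) \<and>
      (\<lambda>K. norm ((\<integral>\<omega>. exact_outcome f c P (\<lambda>_. z\<^sub>0) Q U \<omega> \<partial>M)
                 - (\<integral>\<omega>. truncated_outcome f \<phi> K P (\<lambda>m _. x\<^sub>0 m) Q U \<omega> \<partial>M)))
        \<in> O(\<lambda>K. real K powr (- min s\<^sub>c s\<^sub>z\<^sub>0))"
    if meas: "\<forall>s. (\<lambda>\<omega>. f (P \<omega>) s (Q \<omega>) (U \<omega>)) \<in> borel_measurable M"
      and int: "integrable M (exact_outcome f c P (\<lambda>_. z\<^sub>0) Q U)" for P Q U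
  proof (intro conjI allI impI)
    let ?X = "exact_outcome f c P (\<lambda>_. z\<^sub>0) Q U"
    let ?Y = "\<lambda>K. truncated_outcome f \<phi> K P (\<lambda>m _. x\<^sub>0 m) Q U"
    \<comment> \<open>Under the intervention the scores are constant, so the functional term is one
      fixed scalar and \<open>meas\<close> applies at that scalar.\<close>
    have Y: "?Y K \<in> borel_measurable M" for K
      using meas unfolding truncated_outcome_def by blast
    \<comment> \<open>Both outcomes share the values of \<open>P\<close>, \<open>Q\<close>,
      \<open>U\<close> at each sample point, so the uniform bound \<open>err\<close> applies surely,
      not just almost surely.\<close>
    have le: "norm (?X \<omega> - ?Y K \<omega>) \<le> \<epsilon> K" if "K \<ge> 1" for K \<omega>
      using err[OF that] unfolding exact_outcome_def truncated_outcome_def S_def .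
    show "integrable M (?Y K)" if "K \<ge> 1" for K
      using int Y le[OF that] by (rule expectation_dist_le(1))
    have "norm ((\<integral>\<omega>. ?X \<omega> \<partial>M) - (\<integral>\<omega>. ?Y K \<omega> \<partial>M)) \<le> \<epsilon> K" if "K \<ge> 1" for K
      using int Y le[OF that] by (rule expectation_dist_le(2))
    then show "(\<lambda>K. norm ((\<integral>\<omega>. ?X \<omega> \<partial>M) - (\<integral>\<omega>. ?Y K \<omega> \<partial>M)))
        \<in> O(\<lambda>K. real K powr (- min s\<^sub>c s\<^sub>z\<^sub>0))"
      using rate unfolding \<epsilon>_def by (rule norm_bigo_powrI)
  qed
  show ?thesis
    using pointwise bigo mean unfolding S_def by blast
qed

end
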